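(* Let $n,k$ be positive integers. If the Kneser graph $KG(n,k)$ is $\lambda_2$-optimal and $n\geq \frac{3k^2-3k+10}{2}$, then $$\operatorname{sn}(KG(n,k))=\operatorname{gon}(KG(n,k))=\binom{n-1}{k}.$$
   Context: Kneser graph: $KG(n,k)$ is the simple graph whose vertices are the $k$-element subsets of $[n]=\{1,\dots,n\}$, two vertices being adjacent if and only if the subsets are disjoint. Gonality: let $G$ be a finite connected simple graph. A divisor on $G$ is a function $D:V(G)\to\mathbb{Z}$; its degree is $\deg(D)=\sum_{v}D(v)$; it is effective if $D(v)\ge 0$ for all $v$. Firing a vertex $v$ replaces $D$ by the divisor obtained by decreasing $D(v)$ by the number of neighbours of $v$ and increasing $D(w)$ by $1$ for each neighbour $w$ of $v$. Two divisors are equivalent if one is obtained from the other by a finite sequence of firings. The rank $\operatorname{rk}(D)$ is $-1$ if $D$ is not equivalent to an effective divisor, and otherwise is the largest integer $r\ge 0$ such that $D-E$ is equivalent to an effective divisor for every effective divisor $E$ of degree $r$. The gonality is $\operatorname{gon}(G)=\min\{\deg(D):\operatorname{rk}(D)\ge 1\}$. Scramble number: an egg is a nonempty set of vertices of $G$ inducing a connected subgraph; a scramble $\mathcal{S}$ is a finite set of eggs. A hitting set of $\mathcal{S}$ is a set of vertices meeting every egg; $h(\mathcal{S})$ is the minimum size of a hitting set. An egg-cut of $\mathcal{S}$ is a set $C$ of edges such that at least two distinct connected components of the graph obtained by deleting $C$ each contain an egg; $e(\mathcal{S})$ is the minimum size of an egg-cut, with $e(\mathcal{S})=\infty$ if there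 is none. The order of $\mathcal{S}$ is $\min\{h(\mathcal{S}),e(\mathcal{S})\}$, and $\operatorname{sn}(G)$ is the maximum order of a scramble on $G$. $\lambda_2$-optimality: the uniform edge scramble on $G$ is the scramble whose eggs are exactly the two-element sets $\{u,v\}$ with $uv$ an edge of $G$. The graph $KG(n,k)$ is called $\lambda_2$-optimal if its uniform edge scramble $\mathcal{S}$ satisfies $e(\mathcal{S})=2\left(\binom{n-k}{k}-1\right)$. *)

theory Defs
  imports Complex_Main "HOL-Library.Extended_Nat"
begin

section \<open>Finite simple graphs\<close>

record 'a ugraph =
  verts :: "'a set"
  edges :: "'a set set"

definition simple_graph :: "'a ugraph \<Rightarrow> bool" where
  "simple_graph G \<longleftrightarrow> finite (verts G) \<and> (\<forall>e\<in>edges G. e \<subseteq> verts G \<and> card e = 2)"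

definition nbrs :: "'a ugraph \<Rightarrow> 'a \<Rightarrow> 'a set" where
  "nbrs G v = {w \<in> verts G. {v, w} \<in> edges G}"

definition adj_rel :: "'a ugraph \<Rightarrow> ('a \<times> 'a) set" where
  "adj_rel G = {(u, v). u \<in> verts G \<and> v \<in> nbrs G u}"

definition conn_rel :: "'a ugraph \<Rightarrow> ('a \<times> 'a) set" where
  "conn_rel G = (adj_rel G)\<^sup>* \<inter> (verts G \<times> verts G)"

definition components :: "'a ugraph \<Rightarrow> 'a set set" where
  "components G = verts G // conn_rel G"

definition connected_graph :: "'a ugraph \<Rightarrow> bool" where
  "connected_graph G \<longleftrightarrow> verts G \<noteq> {} \<and> (\<forall>u\<in>verts G. \<forall>v\<in>verts G. (u, v) \<in> conn_rel G)"

definition induced :: "'a ugraph \<Rightarrow> 'a set \<Rightarrow> 'a ugraph" where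
  "induced G U = \<lparr>verts = verts G \<inter> U, edges = {e \<in> edges G. e \<subseteq> U}\<rparr>"

definition delete_edges :: "'a ugraph \<Rightarrow> 'a set set \<Rightarrow> 'a ugraph" where
  "delete_edges G C = \<lparr>verts = verts G, edges = edges G - C\<rparr>"


section \<open>Kneser graphs\<close>

text \<open>For \<open>k \<ge> 1\<close> disjoint vertices are automatically distinct; the condition \<open>A \<noteq> B\<close> only
  excludes a loop in the degenerate case \<open>k = 0\<close>.\<close>

definition kneser :: "nat \<Rightarrow> nat \<Rightarrow> nat set ugraph" where
  "kneser n k =
    (let V = {A. A \<subseteq> {1..n} \<and> card A = k}
     in \<lparr>verts = V, edges = {{A, B} | A B. A \<in> V \<and> B \<in> V \<and> A \<noteq> B \<and> A \<inter> B = {}}\<rparr>)"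

lemma simple_graph_kneser: "simple_graph (kneser n k)"
proof -
  have "finite {A. A \<subseteq> {1..n} \<and> card A = k}"
    by (rule finite_subset[of _ "Pow {1..n}"]) auto
  then show ?thesis
    by (auto simp: simple_graph_def kneser_def Let_def card_insert_if)
qed


section \<open>Divisors and gonality\<close>

text \<open>A divisor on \<open>G\<close> is a total function vanishing outside the vertex set.\<close>

definition divisor :: "'a ugraph \<Rightarrow> ('a \<Rightarrow> int) \<Rightarrow> bool" where
  "divisor G D \<longleftrightarrow> (\<forall>v. v \<notin> verts G \<longrightarrow> D v = 0)"

definition deg :: "'a ugraph \<Rightarrow> ('a \<Rightarrow> int) \<Rightarrow> int" where
  "deg G D = (\<Sum>v\<in>verts G. D v)"

definition effective :: "'a ugraph \<Rightarrow> ('a \<Rightarrow> int) \<Rightarrow> bool" where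
  "effective G D \<longleftrightarrow> divisor G D \<and> (\<forall>v\<in>verts G. D v \<ge> 0)"

definition fire :: "'a ugraph \<Rightarrow> 'a \<Rightarrow> ('a \<Rightarrow> int) \<Rightarrow> ('a \<Rightarrow> int)" where
  "fire G v D = (\<lambda>w. if w = v then D w - int (card (nbrs G v))
                      else if w \<in> nbrs G v then D w + 1
                      else D w)"

definition fires_to :: "'a ugraph \<Rightarrow> ('a \<Rightarrow> int) \<Rightarrow> ('a \<Rightarrow> int) \<Rightarrow> bool" where
  "fires_to G = (\<lambda>D D'. \<exists>v\<in>verts G. D' = fire G v D)\<^sup>*\<^sup>*"

definition div_equiv :: "'a ugraph \<Rightarrow> ('a \<Rightarrow> int) \<Rightarrow> ('a \<Rightarrow> int) \<Rightarrow> bool" where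
  "div_equiv G D D' \<longleftrightarrow> fires_to G D D' \<or> fires_to G D' D"

definition equiv_effective :: "'a ugraph \<Rightarrow> ('a \<Rightarrow> int) \<Rightarrow> bool" where
  "equiv_effective G D \<longleftrightarrow> (\<exists>D'. effective G D' \<and> div_equiv G D D')"

text \<open>The \<open>GREATEST\<close> exists whenever the vertex set is finite and nonempty: firing preserves
  degrees, so every such \<open>r\<close> is at most \<open>deg G D\<close>.\<close>

definition div_rank :: "'a ugraph \<Rightarrow> ('a \<Rightarrow> int) \<Rightarrow> int" where
  "div_rank G D =
    (if equiv_effective G D
     then int (GREATEST r::nat. \<forall>E. effective G E \<and> deg G E = int r
                 \<longrightarrow> equiv_effective G (\<lambda>v. D v - E v))
     else -1)"

definition gonality :: "'a ugraph \<Rightarrow> int" where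
  "gonality G = (LEAST d. \<exists>D. divisor G D \<and> div_rank G D \<ge> 1 \<and> deg G D = d)"


section \<open>Scramble number\<close>

definition egg :: "'a ugraph \<Rightarrow> 'a set \<Rightarrow> bool" where
  "egg G U \<longleftrightarrow> U \<noteq> {} \<and> U \<subseteq> verts G \<and> connected_graph (induced G U)"

definition scramble :: "'a ugraph \<Rightarrow> 'a set set \<Rightarrow> bool" where
  "scramble G S \<longleftrightarrow> finite S \<and> (\<forall>U\<in>S. egg G U)"

definition hitting_set :: "'a ugraph \<Rightarrow> 'a set set \<Rightarrow> 'a set \<Rightarrow> bool" where
  "hitting_set G S H \<longleftrightarrow> H \<subseteq> verts G \<and> (\<forall>U\<in>S. H \<inter> U \<noteq> {})"

definition hitting_number :: "'a ugraph \<Rightarrow> 'a set set \<Rightarrow> nat" where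
  "hitting_number G S = (LEAST m. \<exists>H. hitting_set G S H \<and> card H = m)"

definition egg_cut :: "'a ugraph \<Rightarrow> 'a set set \<Rightarrow> 'a set set \<Rightarrow> bool" where
  "egg_cut G S C \<longleftrightarrow> C \<subseteq> edges G \<and>
    (\<exists>X\<in>components (delete_edges G C). \<exists>Y\<in>components (delete_edges G C).
       X \<noteq> Y \<and> (\<exists>U\<in>S. U \<subseteq> X) \<and> (\<exists>U\<in>S. U \<subseteq> Y))"

text \<open>In \<open>enat\<close>, a nonempty infimum is a minimum, and the infimum of the empty set is \<open>\<infinity>\<close>.\<close>

definition egg_cut_number :: "'a ugraph \<Rightarrow> 'a set set \<Rightarrow> enat" where
  "egg_cut_number G S = (INF C\<in>{C. egg_cut G S C}. enat (card C))"

definition scramble_order :: "'a ugraph \<Rightarrow> 'a set set \<Rightarrow> enat" where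
  "scramble_order G S = min (enat (hitting_number G S)) (egg_cut_number G S)"

definition scramble_number :: "'a ugraph \<Rightarrow> enat" where
  "scramble_number G = Max {scramble_order G S | S. scramble G S}"


section \<open>Optimality of the uniform edge scramble\<close>

definition uniform_edge_scramble :: "'a ugraph \<Rightarrow> 'a set set" where
  "uniform_edge_scramble G = {{u, v} | u v. {u, v} \<in> edges G}"

text \<open>The subtraction is on \<open>nat\<close>, but it truncates only for \<open>k \<ge> 1\<close> and \<open>n < 2 * k\<close>; then the
  graph has no edges, so the egg-cut number is \<open>\<infinity>\<close> and the predicate is false in any case.\<close>

definition lambda2_optimal :: "nat \<Rightarrow> nat \<Rightarrow> bool" where
  "lambda2_optimal n k \<longleftrightarrow>
    egg_cut_number (kneser n k) (uniform_edge_scramble (kneser n k))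
      = enat (2 * (((n - k) choose k) - 1))"

end

theory Submission
  imports Defs "HOL-Combinatorics.Permutations"
begin

text \<open>
  For every scramble and every divisor of positive rank, the order of the scramble is at most the
  degree of the divisor: if an effective divisor \<open>D\<close> misses an egg that an equivalent effective
  divisor \<open>D - L f\<close> hits, firing the set where \<open>f\<close> is maximal keeps the divisor effective, and
  it can only lose an egg if at least an egg-cut's worth of chips crosses the boundary of that
  set. So if the degree is below the size of every egg-cut, the hit eggs never decrease, and
  eventually the support of some equivalent divisor is a hitting set.

  Hence \<open>sn \<le> gon\<close>. One chip on every vertex outside an independent set gives positive rank, so
  the independent set of all \<open>k\<close>-sets containing a fixed point yields
  \<open>gon \<le> binomial (n - 1) k\<close>. For the lower bound take the uniform edge scramble: its hitting
  sets are vertex covers, whose complements are intersecting families, so by Erdos-Ko-Rado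
  (proved by Katona's cyclic permutation argument) they have at least \<open>binomial (n - 1) k\<close>
  elements; and the hypothesis on \<open>n\<close> makes
  \<open>2 * (binomial (n - k) k - 1) \<ge> binomial (n - 1) k\<close>.
\<close>

section \<open>Chip firing and scrambles\<close>

text \<open>The graph Laplacian: \<open>D v - lap G f v\<close> is what \<open>v\<close> holds after
  every vertex \<open>w\<close> has fired \<open>f w\<close> times, where a negative value means
  borrowing.\<close>

definition lap :: "'a ugraph \<Rightarrow> ('a \<Rightarrow> int) \<Rightarrow> 'a \<Rightarrow> int" where
  "lap G f v = (\<Sum>w\<in>nbrs G v. f v - f w)"

lemma nbrs_subset: "nbrs G v \<subseteq> verts G"
  by (auto simp: nbrs_def)

lemma finite_nbrs: "simple_graph G \<Longrightarrow> finite (nbrs G v)"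
  using nbrs_subset finite_subset by (metis simple_graph_def)

lemma nbrs_sym: "v \<in> verts G \<Longrightarrow> w \<in> nbrs G v \<Longrightarrow> v \<in> nbrs G w"
  by (auto simp: nbrs_def insert_commute)

lemma not_in_nbrs: "simple_graph G \<Longrightarrow> v \<notin> nbrs G v"
  by (auto simp: nbrs_def simple_graph_def)

lemma lap_add: "lap G (\<lambda>v. f v + g v) v = lap G f v + lap G g v"
  by (simp add: lap_def sum.distrib[symmetric] algebra_simps)

lemma lap_diff: "lap G (\<lambda>v. f v - g v) v = lap G f v - lap G g v"
  by (simp add: lap_def sum_subtractf[symmetric] algebra_simps)

lemma lap_minus: "lap G (\<lambda>v. - f v) v = - lap G f v"
  by (simp add: lap_def sum_negf[symmetric])

lemma lap_cong:
  assumes "\<And>v. v \<in> verts G \<Longrightarrow> f v = g v" and "v \<in> verts G"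
  shows "lap G f v = lap G g v"
  unfolding lap_def using assms nbrs_subset by (intro sum.cong) fastforce+

lemma lap_const: "lap G (\<lambda>v. c) v = 0"
  by (simp add: lap_def)

text \<open>The differences \<open>f v - f w\<close> and \<open>f w - f v\<close> along an edge
  cancel. Hence firing preserves degrees.\<close>

lemma sum_lap:
  assumes "simple_graph G"
  shows "(\<Sum>v\<in>verts G. lap G f v) = 0"
proof -
  have fin: "finite (verts G)"
    using assms by (simp add: simple_graph_def)
  \<comment> \<open>Extending the differences by 0 to all pairs of vertices gives the double sum a
    fixed index range, so that it can be swapped.\<close>
  define a where "a = (\<lambda>v w. if {v, w} \<in> edges G then f v - f w else 0)"
  have *: "lap G f v = (\<Sum>w\<in>verts G. a v w)" for v
    unfolding lap_def a_def nbrs_def using fin by (simp add: sum.If_cases Int_def)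
  have "(\<Sum>v\<in>verts G. \<Sum>w\<in>verts G. a v w) = (\<Sum>v\<in>verts G. \<Sum>w\<in>verts G. a w v)"
    by (rule sum.swap)
  also have "\<dots> = (\<Sum>v\<in>verts G. \<Sum>w\<in>verts G. - a v w)"
    by (intro sum.cong) (auto simp: a_def insert_commute)
  also have "\<dots> = - (\<Sum>v\<in>verts G. \<Sum>w\<in>verts G. a v w)"
    by (simp add: sum_negf)
  finally show ?thesis
    by (simp add: *)
qed

text \<open>With arbitrary integer scripts \<open>f\<close>, symmetry and transitivity amount to
  negating and adding scripts. A firing sequence in either direction yields such a script.\<close>

definition lin_equiv :: "'a ugraph \<Rightarrow> ('a \<Rightarrow> int) \<Rightarrow> ('a \<Rightarrow> int) \<Rightarrow> bool" where
  "lin_equiv G D D' \<longleftrightarrow> (\<exists>f. \<forall>v\<in>verts G. D' v = D v - lap G f v)"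

lemma lin_equiv_refl: "lin_equiv G D D"
  unfolding lin_equiv_def by (intro exI[of _ "\<lambda>_. 0"]) (simp add: lap_const)

lemma lin_equiv_sym: "lin_equiv G D D' \<Longrightarrow> lin_equiv G D' D"
  unfolding lin_equiv_def by (metis (no_types, lifting) lap_minus diff_minus_eq_add diff_add_cancel)

lemma lin_equiv_trans:
  assumes "lin_equiv G D D'" "lin_equiv G D' D''"
  shows "lin_equiv G D D''"
proof -
  obtain f g where "\<forall>v\<in>verts G. D' v = D v - lap G f v" "\<forall>v\<in>verts G. D'' v = D' v - lap G g v"
    using assms unfolding lin_equiv_def by blast
  then show ?thesis
    unfolding lin_equiv_def by (intro exI[of _ "\<lambda>v. f v + g v"]) (simp add: lap_add)
qed

lemma lin_equiv_deg:
  assumes "simple_graph G" "lin_equiv G D D'"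
  shows "deg G D' = deg G D"
proof -
  obtain f where "\<forall>v\<in>verts G. D' v = D v - lap G f v"
    using assms unfolding lin_equiv_def by blast
  then have "deg G D' = (\<Sum>v\<in>verts G. D v - lap G f v)"
    unfolding deg_def by (intro sum.cong) auto
  then show ?thesis
    by (simp add: sum_subtractf sum_lap[OF assms(1)] deg_def)
qed

lemma lin_equiv_fire:
  assumes "simple_graph G" "v \<in> verts G"
  shows "lin_equiv G D (fire G v D)"
proof -
  have "fire G v D w = D w - lap G (\<lambda>x. if x = v then 1 else 0) w" if "w \<in> verts G" for w
  proof (cases "w = v")
    case True
    have "lap G (\<lambda>x. if x = v then 1 else 0) v = (\<Sum>w\<in>nbrs G v. 1)"
      unfolding lap_def using not_in_nbrs[OF assms(1)] by (intro sum.cong) auto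
    then show ?thesis
      using True by (simp add: fire_def)
  next
    case False
    have "lap G (\<lambda>x. if x = v then 1 else 0) w = (\<Sum>x\<in>nbrs G w. if x = v then -1 else 0)"
      unfolding lap_def using False by (intro sum.cong) auto
    also have "\<dots> = (if w \<in> nbrs G v then -1 else 0)"
      using nbrs_sym[of v G w] nbrs_sym[of w G v] assms(2) that finite_nbrs[OF assms(1)] by auto
    finally show ?thesis
      using False by (simp add: fire_def)
  qed
  then show ?thesis
    unfolding lin_equiv_def by blast
qed

lemma lin_equiv_fires_to:
  assumes "simple_graph G" "fires_to G D D'"
  shows "lin_equiv G D D'"
  using assms(2) unfolding fires_to_def
  by (induction rule: rtranclp_induct)
     (auto intro: lin_equiv_refl lin_equiv_trans lin_equiv_fire[OF assms(1)])

lemma lin_equiv_div_equiv: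
  "simple_graph G \<Longrightarrow> div_equiv G D D' \<Longrightarrow> lin_equiv G D D'"
  unfolding div_equiv_def using lin_equiv_fires_to lin_equiv_sym by metis

lemma deg_effective_nonneg: "effective G D \<Longrightarrow> 0 \<le> deg G D"
  unfolding effective_def deg_def by (simp add: sum_nonneg)

lemma deg_diff: "deg G (\<lambda>v. D v - E v) = deg G D - deg G E"
  by (simp add: deg_def sum_subtractf)

section \<open>Rank at least one\<close>

definition chip :: "'a \<Rightarrow> nat \<Rightarrow> 'a \<Rightarrow> int" where
  "chip v r = (\<lambda>w. if w = v then int r else 0)"

lemma deg_chip: "simple_graph G \<Longrightarrow> v \<in> verts G \<Longrightarrow> deg G (chip v r) = int r"
  unfolding deg_def chip_def simple_graph_def by simp

lemma effective_chip: "v \<in> verts G \<Longrightarrow> effective G (chip v r)"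
  by (auto simp: effective_def chip_def divisor_def)

lemma equiv_effective_deg_nonneg:
  assumes "simple_graph G" "equiv_effective G D"
  shows "0 \<le> deg G D"
  using assms deg_effective_nonneg lin_equiv_deg lin_equiv_div_equiv
  unfolding equiv_effective_def by metis

definition rank_ge :: "'a ugraph \<Rightarrow> ('a \<Rightarrow> int) \<Rightarrow> nat \<Rightarrow> bool" where
  "rank_ge G D r \<longleftrightarrow> (\<forall>E. effective G E \<and> deg G E = int r
                 \<longrightarrow> equiv_effective G (\<lambda>v. D v - E v))"

text \<open>Test the rank condition with all \<open>r\<close> chips on \<open>v\<close>: what
  remains has degree \<open>deg G D - r\<close>, which cannot be negative.\<close>

lemma rank_ge_bound:
  assumes "simple_graph G" "v \<in> verts G" "rank_ge G D r"
  shows "r \<le> nat (deg G D)"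
proof -
  have "equiv_effective G (\<lambda>w. D w - chip v r w)"
    using assms deg_chip effective_chip unfolding rank_ge_def by metis
  then have "0 \<le> deg G D - int r"
    using equiv_effective_deg_nonneg[OF assms(1)] deg_chip[OF assms(1,2)] by (metis deg_diff)
  then show ?thesis
    by simp
qed

text \<open>The \<open>GREATEST\<close> is attained because \<open>r = 0\<close> qualifies and
  \<open>rank_ge_bound\<close> caps \<open>r\<close>. The existential over \<open>r\<close> avoids
  showing that \<open>rank_ge\<close> passes to smaller \<open>r\<close>.\<close>

lemma div_rank_ge_1_iff:
  assumes G: "simple_graph G" and v: "v \<in> verts G" and eff: "equiv_effective G D"
  shows "div_rank G D \<ge> 1 \<longleftrightarrow> (\<exists>r\<ge>1. rank_ge G D r)"
proof -
  have *: "div_rank G D = int (GREATEST r. rank_ge G D r)"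
    unfolding div_rank_def rank_ge_def using eff by simp
  have 0: "rank_ge G D 0"
    unfolding rank_ge_def
  proof (intro allI impI)
    fix E assume E: "effective G E \<and> deg G E = int 0"
    then have "\<forall>v\<in>verts G. E v = 0"
      using G by (auto simp: effective_def deg_def simple_graph_def sum_nonneg_eq_0_iff)
    then have "E v = 0" for v
      using E by (cases "v \<in> verts G") (auto simp: effective_def divisor_def)
    then show "equiv_effective G (\<lambda>v. D v - E v)"
      using eff by simp
  qed
  have bd: "\<And>r. rank_ge G D r \<Longrightarrow> r \<le> nat (deg G D)"
    using rank_ge_bound[OF G v] .
  have "rank_ge G D (GREATEST r. rank_ge G D r)"
    using GreatestI_nat[of "rank_ge G D", OF 0 bd] .
  moreover have "r \<le> (GREATEST r. rank_ge G D r)" if "rank_ge G D r" for r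
    using Greatest_le_nat[of "rank_ge G D", OF that bd] .
  ultimately show ?thesis
    unfolding * by (metis le_trans of_nat_1 of_nat_le_iff)
qed

text \<open>Take \<open>r\<close> chips away from \<open>v\<close>, move to an effective divisor,
  and put them back: \<open>v\<close> then holds at least \<open>r \<ge> 1\<close> chips.\<close>

lemma div_rank_ge_1D:
  assumes G: "simple_graph G" and "div_rank G D \<ge> 1" and v: "v \<in> verts G"
  obtains f where "\<And>w. w \<in> verts G \<Longrightarrow> 0 \<le> D w - lap G f w" and "1 \<le> D v - lap G f v"
proof -
  have "equiv_effective G D"
    using assms(2) unfolding div_rank_def by (auto split: if_splits)
  then obtain r where r: "r \<ge> 1" "rank_ge G D r"
    using div_rank_ge_1_iff[OF G v] assms(2) by blast
  then have "equiv_effective G (\<lambda>w. D w - chip v r w)"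
    using deg_chip[OF G v] effective_chip[OF v] unfolding rank_ge_def by metis
  then obtain D' where D': "effective G D'" and "div_equiv G (\<lambda>w. D w - chip v r w) D'"
    unfolding equiv_effective_def by blast
  then obtain f where f: "\<forall>w\<in>verts G. D' w = D w - chip v r w - lap G f w"
    using lin_equiv_div_equiv[OF G] unfolding lin_equiv_def by blast
  have "0 \<le> D w - lap G f w - chip v r w" if "w \<in> verts G" for w
    using D' f that by (auto simp: effective_def)
  from this show ?thesis
    using r v by (intro that[of f]) (force simp: chip_def split: if_splits)+
qed

section \<open>Eggs and the edge boundary of a vertex set\<close>

lemma egg_crossing_edge:
  assumes "egg G E" "u \<in> E" "u \<in> U" "w \<in> E" "w \<notin> U"
  obtains x y where "x \<in> E" "x \<in> U" "y \<in> E" "y \<notin> U" "y \<in> nbrs G x"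
proof -
  have "(u, w) \<in> (adj_rel (induced G E))\<^sup>*"
    using assms unfolding egg_def connected_graph_def conn_rel_def
    by (auto simp: induced_def)
  then have "w \<in> U \<or> (\<exists>x y. x \<in> E \<and> x \<in> U \<and> y \<in> E \<and> y \<notin> U \<and> y \<in> nbrs G x)"
  proof (induction rule: rtrancl_induct)
    case base
    then show ?case using assms by blast
  next
    case (step x y)
    then show ?case
      by (auto simp: adj_rel_def induced_def nbrs_def)
  qed
  then show ?thesis
    using assms that by blast
qed

lemma egg_connected_delete_edges:
  assumes "egg G E" "x \<in> E" "y \<in> E" "\<And>e. e \<in> C \<Longrightarrow> \<not> e \<subseteq> E"
  shows "(x, y) \<in> conn_rel (delete_edges G C)"
proof -
  have "(x, y) \<in> (adj_rel (induced G E))\<^sup>*"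
    using assms(1-3) unfolding egg_def connected_graph_def conn_rel_def
    by (auto simp: induced_def)
  moreover have "adj_rel (induced G E) \<subseteq> adj_rel (delete_edges G C)"
    using assms(4) by (auto simp: adj_rel_def induced_def nbrs_def delete_edges_def)
  ultimately have "(x, y) \<in> (adj_rel (delete_edges G C))\<^sup>*"
    using rtrancl_mono by blast
  then show ?thesis
    using assms by (auto simp: conn_rel_def delete_edges_def egg_def)
qed

definition cut_edges :: "'a ugraph \<Rightarrow> 'a set \<Rightarrow> 'a set set" where
  "cut_edges G U = {e \<in> edges G. e \<inter> U \<noteq> {} \<and> \<not> e \<subseteq> U}"

text \<open>Once the boundary of \<open>U\<close> is deleted no path leaves \<open>U\<close>, while
  \<open>T\<close> and \<open>E\<close> keep all their inner edges and so each stay within one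
  component.\<close>

lemma egg_cut_cut_edges:
  assumes S: "scramble G S" and T: "T \<in> S" "T \<subseteq> U" and E: "E \<in> S" "E \<inter> U = {}"
  shows "egg_cut G S (cut_edges G U)"
proof -
  let ?H = "delete_edges G (cut_edges G U)"
  have eggs: "egg G T" "egg G E"
    using S T E by (auto simp: scramble_def)
  obtain t e where t: "t \<in> T" and e: "e \<in> E"
    using eggs by (auto simp: egg_def)
  have V: "t \<in> verts ?H" "e \<in> verts ?H"
    using t e eggs by (auto simp: egg_def delete_edges_def)
  have 1: "T \<subseteq> conn_rel ?H `` {t}"
    using egg_connected_delete_edges[OF eggs(1) t, of _ "cut_edges G U"] T
    by (auto simp: cut_edges_def)
  have 2: "E \<subseteq> conn_rel ?H `` {e}"
    using egg_connected_delete_edges[OF eggs(2) e, of _ "cut_edges G U"] E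
    by (auto simp: cut_edges_def)
  have "y \<in> U" if "(t, y) \<in> (adj_rel ?H)\<^sup>*" for y
    using that
  proof (induction rule: rtrancl_induct)
    case base
    then show ?case using t T by blast
  next
    case (step y z)
    then show ?case
      by (auto simp: adj_rel_def nbrs_def delete_edges_def cut_edges_def)
  qed
  then have "e \<notin> conn_rel ?H `` {t}"
    using e E by (auto simp: conn_rel_def)
  then have 3: "conn_rel ?H `` {t} \<noteq> conn_rel ?H `` {e}"
    using 2 e by blast
  have X: "conn_rel ?H `` {t} \<in> components ?H" "conn_rel ?H `` {e} \<in> components ?H"
    using V by (auto simp: components_def quotient_def)
  show ?thesis
    unfolding egg_cut_def
  proof (rule conjI)
    show "cut_edges G U \<subseteq> edges G"
      by (auto simp: cut_edges_def)
    have "\<exists>U\<in>S. U \<subseteq> conn_rel ?H `` {t}" "\<exists>U\<in>S. U \<subseteq> conn_rel ?H `` {e}"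
      using 1 2 T(1) E(1) by auto
    then show "\<exists>X\<in>components ?H. \<exists>Y\<in>components ?H. X \<noteq> Y \<and> (\<exists>U\<in>S. U \<subseteq> X) \<and> (\<exists>U\<in>S. U \<subseteq> Y)"
      using 3 X by meson
  qed
qed

section \<open>Firing a set of vertices\<close>

text \<open>As a script it fires each vertex of \<open>U\<close> once; as a divisor it puts one chip
  on each vertex of \<open>U\<close>. Both readings occur below.\<close>

definition ind :: "'a set \<Rightarrow> 'a \<Rightarrow> int" where
  "ind U v = (if v \<in> U then 1 else 0)"

lemma lap_ind_inside:
  assumes "simple_graph G" "v \<in> U"
  shows "lap G (ind U) v = int (card (nbrs G v - U))"
proof -
  have "lap G (ind U) v = (\<Sum>w\<in>nbrs G v. if w \<in> U then 0 else 1)"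
    unfolding lap_def ind_def using assms(2) by (intro sum.cong) auto
  also have "\<dots> = int (card (nbrs G v - U))"
    using finite_nbrs[OF assms(1)] by (simp add: sum.If_cases Diff_eq)
  finally show ?thesis .
qed

lemma lap_ind_outside:
  assumes "simple_graph G" "v \<notin> U"
  shows "lap G (ind U) v = - int (card (nbrs G v \<inter> U))"
proof -
  have "lap G (ind U) v = (\<Sum>w\<in>nbrs G v. if w \<in> U then -1 else 0)"
    unfolding lap_def ind_def using assms(2) by (intro sum.cong) auto
  also have "\<dots> = - int (card (nbrs G v \<inter> U))"
    using finite_nbrs[OF assms(1)] by (simp add: sum.If_cases Int_def)
  finally show ?thesis .
qed

text \<open>The right-hand side counts the chips leaving \<open>U\<close> when \<open>U\<close> is
  fired, one for each pair of an inner vertex and an outer neighbour; every boundary edge comes from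
  such a pair.\<close>

lemma card_cut_edges_le:
  assumes G: "simple_graph G" and U: "U \<subseteq> verts G"
  shows "int (card (cut_edges G U)) \<le> (\<Sum>v\<in>U. lap G (ind U) v)"
proof -
  have fin: "finite U"
    using G U finite_subset by (auto simp: simple_graph_def)
  let ?P = "SIGMA u:U. nbrs G u - U"
  have finP: "finite ?P"
    using fin finite_nbrs[OF G] by blast
  have "cut_edges G U \<subseteq> (\<lambda>(u, w). {u, w}) ` ?P"
  proof
    fix e assume "e \<in> cut_edges G U"
    then have e: "e \<in> edges G" "e \<inter> U \<noteq> {}" "\<not> e \<subseteq> U"
      by (auto simp: cut_edges_def)
    then obtain u w where uw: "u \<in> e" "u \<in> U" "w \<in> e" "w \<notin> U"
      by blast
    have "card e = 2" "e \<subseteq> verts G"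
      using G e by (auto simp: simple_graph_def)
    then have "e = {u, w}"
      using uw by (metis card_2_iff doubleton_eq_iff empty_iff insert_iff)
    then show "e \<in> (\<lambda>(u, w). {u, w}) ` ?P"
      using uw e(1) \<open>e \<subseteq> verts G\<close> by (intro image_eqI[of _ _ "(u, w)"]) (auto simp: nbrs_def)
  qed
  then have "card (cut_edges G U) \<le> card ?P"
    using surj_card_le[OF finP] by blast
  also have "\<dots> = (\<Sum>u\<in>U. card (nbrs G u - U))"
    using fin finite_nbrs[OF G] by (intro card_SigmaI) auto
  finally have "int (card (cut_edges G U)) \<le> int (\<Sum>u\<in>U. card (nbrs G u - U))"
    by (simp only: of_nat_le_iff)
  also have "\<dots> = (\<Sum>v\<in>U. lap G (ind U) v)"
    using lap_ind_inside[OF G] by simp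
  finally show ?thesis .
qed

lemma lap_ind_crossing_inside:
  assumes "simple_graph G" "x \<in> U" "y \<in> nbrs G x" "y \<notin> U"
  shows "1 \<le> lap G (ind U) x"
proof -
  have "card (nbrs G x - U) \<noteq> 0"
    using assms finite_nbrs[OF assms(1)] by auto
  then show ?thesis
    using lap_ind_inside[OF assms(1,2)] by simp
qed

lemma lap_ind_crossing_outside:
  assumes "simple_graph G" "y \<notin> U" "x \<in> nbrs G y" "x \<in> U"
  shows "lap G (ind U) y \<le> -1"
proof -
  have "card (nbrs G y \<inter> U) \<noteq> 0"
    using assms finite_nbrs[OF assms(1)] by auto
  then show ?thesis
    using lap_ind_outside[OF assms(1,2)] by simp
qed

section \<open>Scramble order against the degree of a divisor of positive rank\<close>

text \<open>The script \<open>f\<close> is carried out in stages, each firing the set where it is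
  maximal. A stage either hits \<open>E\<close> or leaves a script with smaller sum; the natural
  values of \<open>f\<close> make this terminate.\<close>

lemma hit_one_more_egg:
  fixes f :: "'a \<Rightarrow> nat" and D :: "'a \<Rightarrow> int"
  assumes G: "simple_graph G" and S: "scramble G S"
    and no_cut: "\<And>C. egg_cut G S C \<Longrightarrow> deg G D < int (card C)"
    and E: "E \<in> S"
    and "\<And>v. v \<in> verts G \<Longrightarrow> 0 \<le> D v"
    and "\<And>v. v \<in> E \<Longrightarrow> D v = 0"
    and "\<And>v. v \<in> verts G \<Longrightarrow> 0 \<le> D v - lap G (\<lambda>x. int (f x)) v"
    and "x \<in> E" "1 \<le> D x - lap G (\<lambda>x. int (f x)) x"
  shows "\<exists>g. (\<forall>v\<in>verts G. 0 \<le> D v - lap G g v) \<and>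
           (\<forall>T\<in>S. (\<exists>v\<in>T. 1 \<le> D v) \<longrightarrow> (\<exists>v\<in>T. 1 \<le> D v - lap G g v)) \<and>
           (\<exists>v\<in>E. 1 \<le> D v - lap G g v)"
  using assms(3-)
proof (induction "sum f (verts G)" arbitrary: f D rule: less_induct)
  case less
  note no_cut = less.prems(1) and D = less.prems(3) and DE = less.prems(4)
    and Df = less.prems(5) and x = less.prems(6,7)
  have fin: "finite (verts G)"
    using G by (simp add: simple_graph_def)
  have eggE: "egg G E"
    using S E by (simp add: scramble_def)
  then have EV: "E \<subseteq> verts G"
    by (simp add: egg_def)
  let ?f = "\<lambda>x. int (f x)"
  define M where "M = Max (f ` verts G)"
  define U where "U = {v \<in> verts G. f v = M}"
  define D1 where "D1 = (\<lambda>v. D v - lap G (ind U) v)"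
  have le_M: "f v \<le> M" if "v \<in> verts G" for v
    unfolding M_def using that fin by simp
  have "M \<in> f ` verts G"
    unfolding M_def using fin EV x by (intro Max_in) auto
  then have "U \<noteq> {}" "U \<subseteq> verts G"
    by (auto simp: U_def)
  have "M \<noteq> 0"
  proof
    assume "M = 0"
    then have "lap G ?f x = lap G (\<lambda>_. 0) x"
      using le_M x EV by (intro lap_cong) auto
    then show False
      using x DE by (simp add: lap_const)
  qed
  \<comment> \<open>A neighbour outside \<open>U\<close> has a value of \<open>f\<close> at least 1
    below \<open>M\<close>, so on \<open>U\<close> the full script costs at least as many chips as
    firing \<open>U\<close> once.\<close>
  have ind_le: "lap G (ind U) v \<le> lap G ?f v" if "v \<in> U" for v
    unfolding lap_def
  proof (intro sum_mono)
    fix w assume "w \<in> nbrs G v"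
    then have "w \<in> verts G"
      using nbrs_subset by fastforce
    then show "ind U v - ind U w \<le> ?f v - ?f w"
      using le_M[of w] that by (auto simp: ind_def U_def)
  qed
  have D1: "0 \<le> D1 v" if "v \<in> verts G" for v
  proof (cases "v \<in> U")
    case True
    then show ?thesis
      using Df[OF that] ind_le by (force simp: D1_def)
  next
    case False
    then show ?thesis
      using D[OF that] lap_ind_outside[OF G False] by (simp add: D1_def)
  qed
  \<comment> \<open>\<open>x\<close> gains chips under \<open>f\<close>, hence is not in
    \<open>U\<close>. If \<open>E\<close> met \<open>U\<close>, some edge of \<open>E\<close> would
    leave \<open>U\<close>, and its inner endpoint, which has no chips, would have to pay
    one.\<close>
  have EU: "E \<inter> U = {}"
  proof (rule ccontr)
    assume "E \<inter> U \<noteq> {}"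
    then obtain u where u: "u \<in> E" "u \<in> U"
      by blast
    have "x \<notin> U"
    proof
      assume "x \<in> U"
      then have "0 \<le> lap G ?f x"
        using ind_le lap_ind_inside[OF G] by force
      then show False
        using x DE by force
    qed
    then obtain a b where "a \<in> E" "a \<in> U" "b \<notin> U" "b \<in> nbrs G a"
      using egg_crossing_edge[OF eggE u x(1)] by metis
    then have "1 \<le> lap G (ind U) a" "D a = 0" "0 \<le> D1 a"
      using lap_ind_crossing_inside[OF G] DE D1 EV by blast+
    then show False
      by (simp add: D1_def)
  qed
  \<comment> \<open>Vertices outside \<open>U\<close> never lose chips, and those adjacent to
    \<open>U\<close> gain. An egg that becomes unhit therefore lies inside \<open>U\<close>, so the
    boundary of \<open>U\<close> separates it from \<open>E\<close>; but the chips crossing that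
    boundary all come from \<open>D\<close>.\<close>
  have keep: "\<exists>v\<in>T. 1 \<le> D1 v" if T: "T \<in> S" and hit: "\<exists>v\<in>T. 1 \<le> D v" for T
  proof (rule ccontr)
    assume "\<not> (\<exists>v\<in>T. 1 \<le> D1 v)"
    then have unhit: "D1 v \<le> 0" if "v \<in> T" for v
      using that by (meson not_less zless_iff_Suc_zadd int_one_le_iff_zero_less)
    have eggT: "egg G T"
      using S T by (simp add: scramble_def)
    then have TV: "T \<subseteq> verts G"
      by (simp add: egg_def)
    obtain t where t: "t \<in> T" "1 \<le> D t"
      using hit by blast
    have "t \<in> U"
    proof (rule ccontr)
      assume "t \<notin> U"
      then show False
        using unhit[OF t(1)] t lap_ind_outside[OF G] by (simp add: D1_def)
    qed
    have "T \<subseteq> U"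
    proof
      fix w assume "w \<in> T"
      show "w \<in> U"
      proof (rule ccontr)
        assume "w \<notin> U"
        then obtain a b where ab: "a \<in> T" "a \<in> U" "b \<in> T" "b \<notin> U" "b \<in> nbrs G a"
          using egg_crossing_edge[OF eggT t(1) \<open>t \<in> U\<close> \<open>w \<in> T\<close>] by metis
        then have "lap G (ind U) b \<le> -1"
          using lap_ind_crossing_outside[OF G] nbrs_sym TV by (metis subsetD)
        then show False
          using unhit[OF ab(3)] D[of b] TV ab by (auto simp: D1_def)
      qed
    qed
    then have "deg G D < int (card (cut_edges G U))"
      using no_cut egg_cut_cut_edges[OF S T _ E EU] by blast
    also have "\<dots> \<le> (\<Sum>v\<in>U. lap G (ind U) v)"
      using card_cut_edges_le[OF G \<open>U \<subseteq> verts G\<close>] .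
    also have "\<dots> \<le> (\<Sum>v\<in>U. D v)"
      using D1 \<open>U \<subseteq> verts G\<close> by (intro sum_mono) (simp add: D1_def subset_iff)
    also have "\<dots> \<le> deg G D"
      unfolding deg_def using D by (intro sum_mono2[OF fin \<open>U \<subseteq> verts G\<close>]) auto
    finally show False by simp
  qed
  show ?case
  proof (cases "\<exists>v\<in>E. 1 \<le> D1 v")
    case True
    then show ?thesis
      using D1 keep unfolding D1_def by (intro exI[of _ "ind U"]) blast
  next
    case False
    \<comment> \<open>The subtraction is exact because \<open>f\<close> equals
      \<open>M \<noteq> 0\<close> on \<open>U\<close>.\<close>
    define f' where "f' = (\<lambda>v. f v - (if v \<in> U then 1 else 0))"
    have f': "int (f' v) = int (f v) - ind U v" for v
      using \<open>M \<noteq> 0\<close> by (auto simp: f'_def ind_def U_def)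
    have lap_f': "D1 v - lap G (\<lambda>x. int (f' x)) v = D v - lap G ?f v" for v
      unfolding f' lap_diff D1_def by simp
    have "f' v < f v" if "v \<in> U" for v
      using that \<open>M \<noteq> 0\<close> by (auto simp: f'_def U_def)
    moreover have "f' v \<le> f v" for v
      by (simp add: f'_def)
    ultimately have lt: "sum f' (verts G) < sum f (verts G)"
      using \<open>U \<noteq> {}\<close> \<open>U \<subseteq> verts G\<close> by (intro sum_strict_mono_ex1[OF fin]) blast+
    have deg: "deg G D1 = deg G D"
      by (rule lin_equiv_deg[OF G]) (auto simp: lin_equiv_def D1_def)
    have D1E: "D1 v = 0" if "v \<in> E" for v
      using False that D1 EV by force
    have D1f': "0 \<le> D1 v - lap G (\<lambda>x. int (f' x)) v" if "v \<in> verts G" for v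
      using Df[OF that] by (simp only: lap_f')
    have xf': "1 \<le> D1 x - lap G (\<lambda>x. int (f' x)) x"
      using x(2) by (simp only: lap_f')
    have "\<exists>g. (\<forall>v\<in>verts G. 0 \<le> D1 v - lap G g v) \<and>
        (\<forall>T\<in>S. (\<exists>v\<in>T. 1 \<le> D1 v) \<longrightarrow> (\<exists>v\<in>T. 1 \<le> D1 v - lap G g v)) \<and>
        (\<exists>v\<in>E. 1 \<le> D1 v - lap G g v)"
      using no_cut by (intro less.hyps[OF lt _ E D1 D1E D1f' x(1) xf']) (simp add: deg)
    then obtain g where g: "\<forall>v\<in>verts G. 0 \<le> D1 v - lap G g v"
        "\<forall>T\<in>S. (\<exists>v\<in>T. 1 \<le> D1 v) \<longrightarrow> (\<exists>v\<in>T. 1 \<le> D1 v - lap G g v)"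
        "\<exists>v\<in>E. 1 \<le> D1 v - lap G g v"
      by blast
    have eq: "D1 v - lap G g v = D v - lap G (\<lambda>v. ind U v + g v) v" for v
      by (simp add: lap_add D1_def)
    show ?thesis
      using g keep unfolding eq by (intro exI[of _ "\<lambda>v. ind U v + g v"]) blast
  qed
qed

text \<open>Constants have Laplacian 0, so subtracting the minimum yields the natural-valued script
  that \<open>hit_one_more_egg\<close> expects.\<close>

lemma lap_shift_nonneg:
  assumes "finite (verts G)"
  obtains f' :: "'a \<Rightarrow> nat" where "\<And>v. v \<in> verts G \<Longrightarrow> lap G (\<lambda>x. int (f' x)) v = lap G f v"
proof
  fix v assume v: "v \<in> verts G"
  define m where "m = Min (f ` verts G)"
  have "lap G (\<lambda>x. int (nat (f x - Min (f ` verts G)))) v = lap G (\<lambda>x. f x - m) v"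
    using assms by (intro lap_cong v) (auto simp: m_def)
  then show "lap G (\<lambda>x. int (nat (f x - Min (f ` verts G)))) v = lap G f v"
    by (simp add: lap_diff lap_const)
qed

text \<open>Among the effective divisors \<open>D - lap G g\<close>, one hitting the most eggs must
  hit all of them, since \<open>hit_one_more_egg\<close> would improve it otherwise.\<close>

lemma hit_all_eggs:
  assumes G: "simple_graph G" and S: "scramble G S" and V: "verts G \<noteq> {}"
    and no_cut: "\<And>C. egg_cut G S C \<Longrightarrow> deg G D < int (card C)"
    and rank: "div_rank G D \<ge> 1"
  shows "\<exists>g. (\<forall>v\<in>verts G. 0 \<le> D v - lap G g v) \<and> (\<forall>T\<in>S. \<exists>v\<in>T. 1 \<le> D v - lap G g v)"
proof -
  have finS: "finite S"
    using S by (simp add: scramble_def)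
  define hit where "hit = (\<lambda>g. {T \<in> S. \<exists>v\<in>T. 1 \<le> D v - lap G g v})"
  define eff where "eff = (\<lambda>g. \<forall>v\<in>verts G. 0 \<le> D v - lap G g v)"
  have "\<exists>g. eff g"
    using V div_rank_ge_1D[OF G rank] unfolding eff_def by (metis all_not_in_conv)
  moreover have "\<forall>g. eff g \<longrightarrow> card (hit g) < Suc (card S)"
    by (auto simp: hit_def less_Suc_eq_le intro: card_mono finS)
  ultimately obtain g where g: "eff g" and max: "\<And>g'. eff g' \<Longrightarrow> card (hit g') \<le> card (hit g)"
    using ex_has_greatest_nat[of eff _ "\<lambda>g. card (hit g)" "Suc (card S)"] by blast
  have "\<exists>v\<in>E. 1 \<le> D v - lap G g v" if E: "E \<in> S" for E
  proof (rule ccontr)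
    assume unhit: "\<not> (\<exists>v\<in>E. 1 \<le> D v - lap G g v)"
    define D0 where "D0 = (\<lambda>v. D v - lap G g v)"
    have "egg G E"
      using S E by (simp add: scramble_def)
    then obtain x where x: "x \<in> E" and EV: "E \<subseteq> verts G"
      by (auto simp: egg_def)
    obtain f where f: "\<And>w. w \<in> verts G \<Longrightarrow> 0 \<le> D w - lap G f w" "1 \<le> D x - lap G f x"
      using div_rank_ge_1D[OF G rank] x EV by (metis subsetD)
    \<comment> \<open>The script leading from \<open>D0\<close> to the divisor with a chip on
      \<open>x\<close> is \<open>f - g\<close>, up to a constant.\<close>
    obtain f' where f': "\<And>v. v \<in> verts G \<Longrightarrow> lap G (\<lambda>x. int (f' x)) v = lap G (\<lambda>x. f x - g x) v"
      using lap_shift_nonneg G unfolding simple_graph_def by metis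
    have eq: "D0 v - lap G (\<lambda>x. int (f' x)) v = D v - lap G f v" if "v \<in> verts G" for v
      using f'[OF that] by (simp add: D0_def lap_diff)
    have deg: "deg G D0 = deg G D"
      by (rule lin_equiv_deg[OF G]) (auto simp: lin_equiv_def D0_def)
    have D0: "0 \<le> D0 v" if "v \<in> verts G" for v
      using g that by (auto simp: eff_def D0_def)
    have D0E: "D0 v = 0" if "v \<in> E" for v
      using unhit that g EV by (force simp: eff_def D0_def)
    have D0f': "0 \<le> D0 v - lap G (\<lambda>x. int (f' x)) v" if "v \<in> verts G" for v
      using f(1)[OF that] by (simp only: eq[OF that])
    have xf': "1 \<le> D0 x - lap G (\<lambda>x. int (f' x)) x"
      using f(2) eq x EV by auto
    have "\<exists>h. (\<forall>v\<in>verts G. 0 \<le> D0 v - lap G h v) \<and>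
        (\<forall>T\<in>S. (\<exists>v\<in>T. 1 \<le> D0 v) \<longrightarrow> (\<exists>v\<in>T. 1 \<le> D0 v - lap G h v)) \<and>
        (\<exists>v\<in>E. 1 \<le> D0 v - lap G h v)"
      using no_cut by (intro hit_one_more_egg[OF G S _ E D0 D0E D0f' x xf']) (simp add: deg)
    then obtain h where h: "\<forall>v\<in>verts G. 0 \<le> D0 v - lap G h v"
        "\<forall>T\<in>S. (\<exists>v\<in>T. 1 \<le> D0 v) \<longrightarrow> (\<exists>v\<in>T. 1 \<le> D0 v - lap G h v)"
        "\<exists>v\<in>E. 1 \<le> D0 v - lap G h v"
      by blast
    have eq: "D0 v - lap G h v = D v - lap G (\<lambda>v. g v + h v) v" for v
      by (simp add: D0_def lap_add)
    have "eff (\<lambda>v. g v + h v)"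
      using h(1) by (simp add: eff_def eq)
    moreover have "hit g \<subset> hit (\<lambda>v. g v + h v)"
    proof
      have hit: "hit g = {T \<in> S. \<exists>v\<in>T. 1 \<le> D0 v}"
          "hit (\<lambda>v. g v + h v) = {T \<in> S. \<exists>v\<in>T. 1 \<le> D0 v - lap G h v}"
        by (simp_all only: hit_def eq, simp_all only: D0_def)
      show "hit g \<subseteq> hit (\<lambda>v. g v + h v)"
        unfolding hit using h(2) by blast
      have "E \<notin> hit g"
        using unhit by (simp add: hit_def)
      moreover have "E \<in> hit (\<lambda>v. g v + h v)"
        unfolding hit using E h(3) by blast
      ultimately show "hit g \<noteq> hit (\<lambda>v. g v + h v)"
        by blast
    qed
    then have "card (hit g) < card (hit (\<lambda>v. g v + h v))"
      using finS by (intro psubset_card_mono) (auto simp: hit_def)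
    ultimately show False
      using max by force
  qed
  then show ?thesis
    using g unfolding eff_def by blast
qed

theorem scramble_order_le_deg:
  assumes G: "simple_graph G" and S: "scramble G S" and V: "verts G \<noteq> {}"
    and rank: "div_rank G D \<ge> 1"
  shows "scramble_order G S \<le> enat (nat (deg G D))"
proof (cases "\<exists>C. egg_cut G S C \<and> int (card C) \<le> deg G D")
  case True
  then obtain C where C: "egg_cut G S C" "int (card C) \<le> deg G D"
    by blast
  have "egg_cut_number G S \<le> enat (card C)"
    unfolding egg_cut_number_def using C by (intro INF_lower) simp
  also have "\<dots> \<le> enat (nat (deg G D))"
    using C by simp
  finally show ?thesis
    by (simp add: scramble_order_def min.coboundedI2)
next
  case False
  then obtain g where g: "\<forall>v\<in>verts G. 0 \<le> D v - lap G g v"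
      "\<forall>T\<in>S. \<exists>v\<in>T. 1 \<le> D v - lap G g v"
    using hit_all_eggs[OF G S V _ rank] by (meson not_le)
  define D' where "D' = (\<lambda>v. D v - lap G g v)"
  have fin: "finite (verts G)"
    using G by (simp add: simple_graph_def)
  \<comment> \<open>The support meets every egg, and with at least one chip per vertex its size is
    at most the degree.\<close>
  define H where "H = {v \<in> verts G. 1 \<le> D' v}"
  have "hitting_set G S H"
    unfolding hitting_set_def
  proof (intro conjI ballI)
    fix T assume "T \<in> S"
    then obtain v where "v \<in> T" "1 \<le> D' v" "T \<subseteq> verts G"
      using g(2) S by (auto simp: D'_def scramble_def egg_def)
    then show "H \<inter> T \<noteq> {}"
      by (auto simp: H_def)
  qed (auto simp: H_def)
  then have "hitting_number G S \<le> card H"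
    unfolding hitting_number_def by (intro Least_le) blast
  moreover have "int (card H) = (\<Sum>v\<in>H. 1)"
    by simp
  moreover have "\<dots> \<le> (\<Sum>v\<in>H. D' v)"
    by (intro sum_mono) (auto simp: H_def)
  moreover have "\<dots> \<le> deg G D'"
    unfolding deg_def using g(1) fin by (intro sum_mono2) (auto simp: H_def D'_def)
  moreover have "deg G D' = deg G D"
    by (rule lin_equiv_deg[OF G]) (auto simp: lin_equiv_def D'_def)
  ultimately have "hitting_number G S \<le> nat (deg G D)"
    by linarith
  then show ?thesis
    by (simp add: scramble_order_def min.coboundedI1)
qed

section \<open>A positive rank divisor from an independent set\<close>

lemma div_rank_complement_independent:
  assumes G: "simple_graph G" and I: "I \<subseteq> verts G" "I \<noteq> {}"
    and indep: "\<And>u v. u \<in> I \<Longrightarrow> v \<in> I \<Longrightarrow> v \<notin> nbrs G u"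
    and nbr: "\<And>u. u \<in> I \<Longrightarrow> nbrs G u \<noteq> {}"
  shows "div_rank G (ind (verts G - I)) \<ge> 1"
proof -
  define D where "D = ind (verts G - I)"
  have fin: "finite (verts G)"
    using G by (simp add: simple_graph_def)
  have eff: "effective G D"
    by (auto simp: effective_def divisor_def D_def ind_def)
  then have ee: "equiv_effective G D"
    unfolding equiv_effective_def div_equiv_def fires_to_def by blast
  have "rank_ge G D 1"
    unfolding rank_ge_def
  proof (intro allI impI)
    fix E assume "effective G E \<and> deg G E = int 1"
    then have E: "\<forall>v\<in>verts G. 0 \<le> E v" "\<forall>v. v \<notin> verts G \<longrightarrow> E v = 0" "(\<Sum>v\<in>verts G. E v) = 1"
      by (auto simp: effective_def divisor_def deg_def)
    then obtain u where u: "u \<in> verts G" "E u \<noteq> 0"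
      by (metis sum.neutral zero_neq_one)
    have sum: "(\<Sum>v\<in>verts G. E v) = E u + (\<Sum>v\<in>verts G - {u}. E v)"
      using fin u by (simp add: sum.remove)
    moreover have "0 \<le> (\<Sum>v\<in>verts G - {u}. E v)"
      using E(1) by (intro sum_nonneg) auto
    ultimately have "E u = 1" and "(\<Sum>v\<in>verts G - {u}. E v) = 0"
      using u E by (smt (verit))+
    then have "E v = 0" if "v \<noteq> u" for v
      using E fin that sum_nonneg_eq_0_iff[of "verts G - {u}" E] by (cases "v \<in> verts G") auto
    with \<open>E u = 1\<close> have Eu: "E = ind {u}"
      by (auto simp: ind_def)
    show "equiv_effective G (\<lambda>v. D v - E v)"
    proof (cases "u \<in> I")
      case False
      then have "effective G (\<lambda>v. D v - E v)"
        using u by (auto simp: Eu effective_def divisor_def D_def ind_def)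
      then show ?thesis
        unfolding equiv_effective_def div_equiv_def fires_to_def by blast
    next
      case True
      \<comment> \<open>Here \<open>u\<close> borrows one chip from each neighbour: these lie
        outside \<open>I\<close> and each hold a chip, and \<open>u\<close> rises from -1 to at
        least 0. Firing \<open>u\<close> undoes this, which is the second alternative of
        \<open>div_equiv\<close>.\<close>
      define D' where "D' = (\<lambda>v. D v - E v + (if v = u then int (card (nbrs G u))
                                   else if v \<in> nbrs G u then -1 else 0))"
      have "card (nbrs G u) \<noteq> 0"
        using nbr[OF True] finite_nbrs[OF G] by simp
      then have "0 \<le> D' v" if "v \<in> verts G" for v
        using that True indep[OF True, of v] by (auto simp: D'_def Eu D_def ind_def)
      moreover have "D' v = 0" if "v \<notin> verts G" for v
        using that u nbrs_subset[of G u] by (auto simp: D'_def Eu D_def ind_def)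
      ultimately have "effective G D'"
        by (simp add: effective_def divisor_def)
      moreover have "fire G u D' = (\<lambda>v. D v - E v)"
        by (auto simp: fire_def D'_def)
      then have "fires_to G D' (\<lambda>v. D v - E v)"
        unfolding fires_to_def using u(1) by (metis (mono_tags, lifting) r_into_rtranclp)
      ultimately show ?thesis
        unfolding equiv_effective_def div_equiv_def by blast
    qed
  qed
  then show ?thesis
    using div_rank_ge_1_iff[OF G _ ee] I unfolding D_def by fastforce
qed

section \<open>Intersecting families\<close>

text \<open>The cyclic interval of length \<open>k\<close> starting at \<open>i\<close>, written without \<open>mod\<close> so that
  linear arithmetic applies.\<close>

definition arc :: "nat \<Rightarrow> nat \<Rightarrow> nat \<Rightarrow> nat set" where
  "arc n k i = {y. y < n \<and> (i \<le> y \<and> y < i + k \<or> y + n < i + k)}"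

section \<open>Intersecting cyclic intervals\<close>

lemma card_arc:
  assumes "i < n" "k \<le> n"
  shows "card (arc n k i) = k"
proof (cases "i + k \<le> n")
  case True
  then have "arc n k i = {i..<i + k}"
    using assms by (auto simp: arc_def)
  then show ?thesis by simp
next
  case False
  then have "arc n k i = {i..<n} \<union> {..<i + k - n}"
    using assms by (auto simp: arc_def)
  also have "card \<dots> = card {i..<n} + card {..<i + k - n}"
    using assms by (intro card_Un_disjoint) auto
  finally show ?thesis
    using False assms by simp
qed

lemma arc_disjoint:
  assumes "i + k \<le> j" "j + k \<le> i + n" "j < n"
  shows "arc n k i \<inter> arc n k j = {}"
  using assms by (auto simp: arc_def)

text \<open>Katona's pairing: every start in \<open>I\<close> is, modulo \<open>n\<close>, either
  \<open>a + d\<close> or \<open>a + d - k\<close> with \<open>d < k\<close>. The two arcs for one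
  \<open>d\<close> are adjacent and, as \<open>2 * k \<le> n\<close>, disjoint, so each
  \<open>d\<close> is used at most once.\<close>

lemma card_intersecting_arcs_le:
  assumes k: "0 < k" "2 * k \<le> n" and I: "I \<subseteq> {..<n}"
    and inter: "\<And>i j. i \<in> I \<Longrightarrow> j \<in> I \<Longrightarrow> arc n k i \<inter> arc n k j \<noteq> {}"
  shows "card I \<le> k"
proof (cases "I = {}")
  case False
  have fin: "finite I"
    using I finite_subset by blast
  define a where "a = Min I"
  have a: "a \<in> I" "\<And>i. i \<in> I \<Longrightarrow> a \<le> i"
    using False fin by (simp_all add: a_def)
  have near: "j < i + k \<or> i + n < j + k" if "i \<in> I" "j \<in> I" for i j
    using arc_disjoint[of i k j n] inter[OF that] that I by force
  \<comment> \<open>\<open>g\<close> recovers \<open>d\<close>; the second case is a start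
    \<open>a + d - k\<close> that appears as \<open>a + n + d - k\<close>.\<close>
  define g where "g = (\<lambda>i. if i < a + k then i - a else i + k - (a + n))"
  have "inj_on g I"
  proof (rule inj_onI)
    fix i j assume ij: "i \<in> I" "j \<in> I" "g i = g j"
    show "i = j"
      using near[OF ij(1,2)] near[OF ij(2,1)] near[OF a(1) ij(1)] near[OF a(1) ij(2)]
        a(2)[OF ij(1)] a(2)[OF ij(2)] ij(3) k
      unfolding g_def by (auto split: if_splits)
  qed
  moreover have "g ` I \<subseteq> {..<k}"
  proof
    fix x assume "x \<in> g ` I"
    then obtain i where i: "i \<in> I" "x = g i" by blast
    moreover have "i < n"
      using i I by auto
    ultimately show "x \<in> {..<k}"
      using near[OF a(1) i(1)] a(2)[OF i(1)] k unfolding g_def by auto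
  qed
  ultimately show ?thesis
    using card_inj_on_le[of g I "{..<k}"] by simp
qed simp

section \<open>Permutations and Katona's double count\<close>

lemma ex_permutes_image_eq:
  assumes "finite X" "A \<subseteq> X" "B \<subseteq> X" "card A = card B"
  obtains p where "p permutes X" "p ` A = B"
proof -
  have fin: "finite A" "finite B"
    using assms finite_subset by auto
  obtain f where f: "bij_betw f A B"
    using finite_same_card_bij[OF fin assms(4)] by blast
  have "card (X - A) = card (X - B)"
    using assms fin by (simp add: card_Diff_subset)
  then obtain g where g: "bij_betw g (X - A) (X - B)"
    using finite_same_card_bij[of "X - A" "X - B"] assms(1) by blast
  define p where "p = (\<lambda>x. if x \<in> A then f x else if x \<in> X then g x else x)"
  have pA: "bij_betw p A B"
    using f by (subst bij_betw_cong[of A p f]) (auto simp: p_def)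
  moreover have "bij_betw p (X - A) (X - B)"
    using g by (subst bij_betw_cong[of "X - A" p g]) (auto simp: p_def)
  ultimately have "bij_betw p (A \<union> (X - A)) (B \<union> (X - B))"
    by (intro bij_betw_combine) auto
  then have "bij_betw p X X"
    using assms(2,3) by (simp add: Un_absorb1)
  then have "p permutes X"
    by (rule bij_imp_permutes) (use assms(2) in \<open>auto simp: p_def\<close>)
  then show ?thesis
    using that pA by (simp add: bij_betw_def)
qed

text \<open>Composing with a permutation that takes \<open>C\<close> to \<open>B\<close> shows that
  all \<open>k\<close>-subsets are equally frequent images of \<open>A\<close>; these classes
  partition the permutations.\<close>

lemma card_permutes_image_eq:
  assumes X: "finite X" and A: "A \<subseteq> X" "card A = k" and B: "B \<subseteq> X" "card B = k"
  shows "card {p. p permutes X \<and> p ` A = B} * (card X choose k) = fact (card X)"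
proof -
  let ?P = "\<lambda>B. {p. p permutes X \<and> p ` A = B}"
  have eq: "card (?P C) = card (?P B)" if C: "C \<subseteq> X" "card C = k" for C
  proof -
    obtain q where q: "q permutes X" "q ` C = B"
      using ex_permutes_image_eq[OF X C(1) B(1)] C B by metis
    have "bij_betw ((\<circ>) q) (?P C) (?P B)"
    proof (rule bij_betwI[where g = "(\<circ>) (inv q)"])
      show "(\<circ>) q \<in> ?P C \<rightarrow> ?P B"
        using q by (auto simp: image_comp[symmetric] intro: permutes_compose)
      have "inv q ` B = C"
        using q by (metis image_inv_f_f permutes_inj)
      then show "(\<circ>) (inv q) \<in> ?P B \<rightarrow> ?P C"
        using q by (auto simp: image_comp[symmetric] intro: permutes_compose permutes_inv)
    qed (auto simp: fun_eq_iff permutes_inverses[OF q(1)])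
    then show ?thesis
      by (rule bij_betw_same_card)
  qed
  let ?S = "{C. C \<subseteq> X \<and> card C = k}"
  have "{p. p permutes X} = (\<Union>C\<in>?S. ?P C)"
    using A by (auto simp: permutes_in_image subset_iff card_image permutes_inj_on)
  then have "fact (card X) = card (\<Union>C\<in>?S. ?P C)"
    using card_permutations[OF refl X] by simp
  also have "\<dots> = (\<Sum>C\<in>?S. card (?P C))"
    using X finite_permutations[OF X]
    by (intro card_UN_disjoint) (auto intro: finite_subset)
  also have "\<dots> = (\<Sum>C\<in>?S. card (?P B))"
    by (intro sum.cong) (auto simp: eq)
  also have "\<dots> = (card X choose k) * card (?P B)"
    using n_subsets[OF X] by simp
  finally show ?thesis
    by (simp add: mult.commute)
qed

text \<open>Count pairs of a permutation \<open>p\<close> and a start \<open>i\<close> for which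
  \<open>p\<close> maps \<open>A i\<close> to a member of \<open>F\<close>: each \<open>p\<close>
  admits at most \<open>k\<close> starts, and each \<open>i\<close> the same number of
  permutations.\<close>

theorem Erdos_Ko_Rado:
  assumes X: "finite X" and k: "0 < k" "2 * k \<le> card X"
    and F: "\<And>A. A \<in> F \<Longrightarrow> A \<subseteq> X \<and> card A = k"
    and inter: "\<And>A B. A \<in> F \<Longrightarrow> B \<in> F \<Longrightarrow> A \<inter> B \<noteq> {}"
  shows "card F \<le> (card X - 1) choose (k - 1)"
proof -
  define n where "n = card X"
  obtain b where b: "bij_betw b {..<n} X"
    using ex_bij_betw_nat_finite[OF X] by (auto simp: n_def atLeast0LessThan)
  have arc_sub: "arc n k i \<subseteq> {..<n}" for i
    by (auto simp: arc_def)
  \<comment> \<open>\<open>b\<close> arranges \<open>X\<close> on a circle; \<open>A i\<close> is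
    the interval of length \<open>k\<close> starting at position \<open>i\<close>.\<close>
  define A where "A = (\<lambda>i. b ` arc n k i)"
  have A: "A i \<subseteq> X" "card (A i) = k" if "i < n" for i
  proof -
    show "A i \<subseteq> X"
      unfolding A_def using b arc_sub by (auto simp: bij_betw_def)
    have "inj_on b (arc n k i)"
      using b inj_on_subset[OF _ arc_sub] by (auto simp: bij_betw_def)
    then show "card (A i) = k"
      unfolding A_def using card_arc[OF that] k by (simp add: card_image n_def)
  qed
  let ?P = "{p. p permutes X}"
  have finP: "finite ?P"
    using finite_permutations[OF X] .
  have finF: "finite F"
    by (rule finite_subset[of F "Pow X"]) (use X F in auto)
  have per_perm: "card {i \<in> {..<n}. p ` A i \<in> F} \<le> k" if p: "p permutes X" for p
  proof (rule card_intersecting_arcs_le[OF k(1)])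
    show "2 * k \<le> n"
      using k by (simp add: n_def)
    fix i j assume "i \<in> {i \<in> {..<n}. p ` A i \<in> F}" "j \<in> {i \<in> {..<n}. p ` A i \<in> F}"
    then have "p ` A i \<inter> p ` A j \<noteq> {}"
      using inter by blast
    then have "A i \<inter> A j \<noteq> {}"
      using image_Int[OF permutes_inj[OF p], of "A i" "A j"] by auto
    then show "arc n k i \<inter> arc n k j \<noteq> {}"
      using inj_on_image_Int[OF bij_betw_imp_inj_on[OF b] arc_sub arc_sub, of i j]
      unfolding A_def by auto
  qed auto
  have per_arc: "card {p \<in> ?P. p ` A i \<in> F} * (n choose k) = card F * fact n" if "i < n" for i
  proof -
    have "{p \<in> ?P. p ` A i \<in> F} = (\<Union>B\<in>F. {p. p permutes X \<and> p ` A i = B})"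
      by auto
    also have "card \<dots> = (\<Sum>B\<in>F. card {p. p permutes X \<and> p ` A i = B})"
      using finF finP by (intro card_UN_disjoint) (auto intro: finite_subset)
    finally have "card {p \<in> ?P. p ` A i \<in> F} * (n choose k)
        = (\<Sum>B\<in>F. card {p. p permutes X \<and> p ` A i = B} * (n choose k))"
      by (simp add: sum_distrib_right)
    also have "\<dots> = (\<Sum>B\<in>F. fact n)"
      using card_permutes_image_eq[OF X A[OF that]] F unfolding n_def
      by (intro sum.cong) auto
    finally show ?thesis
      by simp
  qed
  have "(\<Sum>i<n. card {p \<in> ?P. p ` A i \<in> F}) = (\<Sum>p\<in>?P. card {i \<in> {..<n}. p ` A i \<in> F})"
    by (rule sum_multicount_gen) (auto simp: finP)
  also have "\<dots> \<le> (\<Sum>p\<in>?P. k)"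
    by (intro sum_mono) (use per_perm in auto)
  also have "\<dots> = fact n * k"
    using card_permutations[OF refl X] by (simp add: n_def)
  finally have "(\<Sum>i<n. card {p \<in> ?P. p ` A i \<in> F}) * (n choose k) \<le> fact n * k * (n choose k)"
    by simp
  then have "(\<Sum>i<n. card F * fact n) \<le> fact n * (k * (n choose k))"
    using per_arc by (simp add: sum_distrib_right mult.assoc)
  also have "k * (n choose k) = n * ((n - 1) choose (k - 1))"
    using k by (simp add: times_binomial_minus1_eq)
  finally have "(n * fact n) * card F \<le> (n * fact n) * ((n - 1) choose (k - 1))"
    by (simp add: algebra_simps)
  moreover have "0 < n"
    using k by (simp add: n_def)
  ultimately show ?thesis
    by (simp add: n_def)
qed

section \<open>The binomial inequality\<close>

text \<open>The falling factorial in a recursive form that \<open>code_simp\<close> evaluates with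
  \<open>k\<close> multiplications.\<close>

fun falling :: "int \<Rightarrow> nat \<Rightarrow> int" where
  "falling m 0 = 1"
| "falling m (Suc k) = m * falling (m - 1) k"

lemma falling_eq: "falling (int m) k = int (fact k * (m choose k))"
proof (induction k arbitrary: m)
  case (Suc k)
  show ?case
  proof (cases m)
    case 0
    then show ?thesis by simp
  next
    case (Suc m')
    have "Suc k * (Suc m' choose Suc k) = Suc m' * (m' choose k)"
      using Suc_times_binomial_eq[of m' k] by (simp add: mult.commute)
    then have "int (Suc m' * (fact k * (m' choose k))) = int (fact (Suc k) * (Suc m' choose Suc k))"
      unfolding fact_Suc by (metis mult.assoc mult.left_commute of_nat_id)
    then show ?thesis
      using Suc.IH[of m'] Suc by (simp add: algebra_simps)
  qed
qed simp

text \<open>These cases are checked numerically because the inequality is nearly sharp for small \<open>k\<close>: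
  at \<open>k = 9\<close> and the least admissible \<open>n\<close>, the ratio of \<open>binomial (n - k) k\<close> to
  \<open>binomial (n - 1) k\<close> exceeds 1/2 by less than 0.00004. As \<open>k\<close> grows the ratio tends to
  \<open>exp (- 2 / 3)\<close>, which leaves room for the exponential estimate.\<close>

lemma binomial_bound_small:
  fixes k :: nat
  assumes "0 < k" "k \<le> 40"
  shows "falling ((3 * int k * int k - 3 * int k + 10) div 2 - 1) k + 2 * falling (int k) k
    \<le> 2 * falling ((3 * int k * int k - 3 * int k + 10) div 2 - int k) k"
proof -
  have "list_all (\<lambda>k. falling ((3 * int k * int k - 3 * int k + 10) div 2 - 1) k + 2 * falling (int k) k
    \<le> 2 * falling ((3 * int k * int k - 3 * int k + 10) div 2 - int k) k) [1..<41]"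
    by code_simp
  then show ?thesis
    using assms by (auto simp: list_all_iff)
qed

section \<open>The estimate for large \<open>k\<close>\<close>

text \<open>69/100 lies between 2/3, the limit of \<open>k * y\<close> below at the least admissible
  \<open>n\<close>, and ln 2, so the exponential stays under 2. It is bounded through its inverse,
  using \<open>1 - t \<le> exp (- t)\<close> at \<open>t = 69 / 12800\<close>.\<close>

lemma exp_69: "exp (69 / 100 :: real) \<le> 1999 / 1000"
proof -
  have "(1 - 69 / 12800 :: real) ^ 128 \<le> exp (- 69 / 12800) ^ 128"
    using exp_ge_add_one_self[of "- 69 / 12800 :: real"] by (intro power_mono) auto
  also have "\<dots> = exp (- (69 / 100))"
    by (simp add: exp_of_nat_mult[symmetric])
  also have "\<dots> = inverse (exp (69 / 100))"
    by (rule exp_minus)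
  finally have "(1 - 69 / 12800 :: real) ^ 128 * exp (69 / 100) \<le> 1"
    by (simp add: field_simps)
  \<comment> \<open>The exponent 128 is split as 8 * 4 * 4, rounding down to short decimals in
    between.\<close>
  moreover have "1000 / 1999 \<le> (1 - 69 / 12800 :: real) ^ 128"
  proof -
    have "(95767 / 100000 :: real) \<le> (1 - 69 / 12800) ^ 8"
      by (simp add: power_divide)
    then have "(95767 / 100000 :: real) ^ 16 \<le> ((1 - 69 / 12800) ^ 8) ^ 16"
      by (rule power_mono) simp
    moreover have "(1000 / 1999 :: real) \<le> (8411 / 10000) ^ 4"
      by (simp add: power_divide)
    moreover have "((8411 / 10000 :: real)) ^ 4 \<le> ((95767 / 100000) ^ 4) ^ 4"
      by (intro power_mono) (simp_all add: power_divide)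
    ultimately show ?thesis
      by (simp only: power_mult[symmetric]) simp
  qed
  ultimately have "1000 / 1999 * exp (69 / 100 :: real) \<le> 1"
    by (meson exp_ge_zero mult_right_mono order_trans)
  then show ?thesis
    by simp
qed

lemma binomial_real_eq: "fact k * real (m choose k) = (\<Prod>i<k. real m - real i)"
  using gbinomial_mult_fact[of k "real m"] by (simp add: binomial_gbinomial atLeast0LessThan)

text \<open>Compare falling factorials factor by factor: \<open>(n - 1 - i) / (n - k - i)\<close> is
  \<open>1 + (k - 1) / (n - k - i)\<close>, which is largest at \<open>i = k - 1\<close>, where it
  equals \<open>1 + y\<close>.\<close>

lemma binomial_ratio_le:
  fixes n k :: nat
  assumes k: "0 < k" "2 * k \<le> n"
  defines "y \<equiv> (real k - 1) / (real n - 2 * real k + 1)"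
  shows "real ((n - 1) choose k) \<le> (1 + y) ^ k * real ((n - k) choose k)"
proof -
  have "(\<Prod>i<k. real (n - 1) - real i) \<le> (\<Prod>i<k. (1 + y) * (real (n - k) - real i))"
  proof (intro prod_mono conjI)
    fix i assume "i \<in> {..<k}"
    then have i: "real i + 1 \<le> real k"
      by auto
    have n: "2 * real k \<le> real n" "real (n - 1) = real n - 1" "real (n - k) = real n - real k"
      using k by (auto simp: of_nat_diff)
    have y0: "0 \<le> y"
      unfolding y_def using k n by simp
    show "0 \<le> real (n - 1) - real i"
      using n i by simp
    have "real k - 1 = y * (real n - 2 * real k + 1)"
      unfolding y_def using n by simp
    also have "\<dots> \<le> y * (real n - real k - real i)"
      using y0 n i by (intro mult_left_mono) auto
    finally show "real (n - 1) - real i \<le> (1 + y) * (real (n - k) - real i)"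
      using n by (simp add: algebra_simps)
  qed
  then have "fact k * real ((n - 1) choose k) \<le> fact k * ((1 + y) ^ k * real ((n - k) choose k))"
    unfolding binomial_real_eq prod.distrib by (simp add: binomial_real_eq[symmetric] algebra_simps)
  then show ?thesis
    by simp
qed

lemma binomial_bound_large:
  fixes n k :: nat
  assumes k: "40 < k" and n: "3 * real k ^ 2 - 3 * real k + 10 \<le> 2 * real n"
  shows "((n - 1) choose k) + 2 \<le> 2 * ((n - k) choose k)"
proof -
  \<comment> \<open>Shifting by 41, the smallest \<open>k\<close> in question, makes the polynomial
    bounds linear in \<open>x \<ge> 0\<close> and its square \<open>q\<close>.\<close>
  define x where "x = real k - 41"
  have x: "real k = x + 41" "0 \<le> x"
    using k by (simp_all add: x_def)
  have kn: "3 * real k \<le> real n"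
    using n x by (auto simp: power2_eq_square algebra_simps) (smt (verit) mult_nonneg_nonneg)
  then have kn': "2 * k \<le> n" "3 * k \<le> n"
    by linarith+
  define y where "y = (real k - 1) / (real n - 2 * real k + 1)"
  have "real k * (real k - 1) \<le> 69 / 100 * (real n - 2 * real k + 1)"
  proof -
    define q where "q = x * x"
    have "0 \<le> q" by (simp add: q_def)
    moreover have "3 * q + 243 * x + 4930 \<le> 2 * real n"
      using n unfolding x(1) q_def by (simp add: power2_eq_square algebra_simps)
    ultimately have "100 * q + 8238 * x + 169589 \<le> 69 * real n"
      using x(2) by linarith
    then show ?thesis
      unfolding x(1) q_def by (simp add: algebra_simps)
  qed
  then have ky: "real k * y \<le> 69 / 100"
    unfolding y_def using kn x by (simp add: field_simps)
  have y0: "0 \<le> y"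
    unfolding y_def using kn x by simp
  have "(1 + y) ^ k \<le> exp y ^ k"
    using y0 exp_ge_add_one_self[of y] by (intro power_mono) auto
  also have "\<dots> = exp (real k * y)"
    by (simp add: exp_of_nat_mult)
  also have "\<dots> \<le> 1999 / 1000"
    using ky exp_69 by (meson exp_le_cancel_iff order_trans)
  finally have "(1 + y) ^ k * real ((n - k) choose k) \<le> 1999 / 1000 * real ((n - k) choose k)"
    by (intro mult_right_mono) auto
  then have le: "real ((n - 1) choose k) \<le> 1999 / 1000 * real ((n - k) choose k)"
    using binomial_ratio_le[of k n] k kn' unfolding y_def by linarith
  \<comment> \<open>The factor 1999/1000 leaves a slack of one thousandth of the binomial, which
    covers the summand 2 once the binomial is at least 2000; \<open>2 ^ 11\<close> is 2048.\<close>
  have "(2 :: real) ^ 11 \<le> 2 ^ k"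
    using k by (intro power_increasing) auto
  also have "\<dots> \<le> (real (n - k) / real k) ^ k"
    using kn kn' k by (intro power_mono) (auto simp: field_simps of_nat_diff)
  also have "\<dots> \<le> real ((n - k) choose k)"
    using kn' by (intro binomial_ge_n_over_k_pow_k) auto
  finally have "real ((n - 1) choose k) + 2 \<le> 2 * real ((n - k) choose k)"
    using le by simp
  then show ?thesis
    by linarith
qed

section \<open>Induction on \<open>n\<close> for small \<open>k\<close>\<close>

text \<open>For \<open>n = 2 * k + m\<close> the left binomial grows by the factor
  \<open>(m + 2 * k) / (m + k)\<close> and the right one by \<open>(m + k + 1) / (m + 1)\<close>.
  The second is at least the first because \<open>k \<le> k * k\<close>, and at least 1, which takes
  care of the summand 2.\<close>

lemma binomial_bound_step:
  fixes n k :: nat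
  assumes k: "0 < k" "2 * k \<le> n" and le: "((n - 1) choose k) + 2 \<le> 2 * ((n - k) choose k)"
  shows "(n choose k) + 2 \<le> 2 * ((Suc n - k) choose k)"
proof -
  obtain m where m: "n = 2 * k + m"
    using k le_Suc_ex by blast
  define a a' b b' where "a = (m + k choose k)" and "a' = (Suc (m + k) choose k)"
    and "b = (2 * k + m - 1 choose k)" and "b' = (2 * k + m choose k)"
  have a: "(m + 1) * a' = (m + k + 1) * a"
    using binomial_absorb_comp[of "Suc (m + k)" k] by (simp add: a_def a'_def)
  have b: "(m + k) * b' = (m + 2 * k) * b"
    using binomial_absorb_comp[of "2 * k + m" k] by (simp add: b_def b'_def add.commute mult_2)
  have ab: "b + 2 \<le> 2 * a"
    using le by (simp add: a_def b_def m add.commute mult_2 add.assoc)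
  have "((m + 1) * (m + k)) * (b' + 2) = (m + 1) * ((m + 2 * k) * b) + 2 * (m + 1) * (m + k)"
    unfolding b[symmetric] by (simp add: algebra_simps)
  also have "\<dots> \<le> (m + k) * (m + k + 1) * (b + 2)"
  proof -
    have "k \<le> k * k" by simp
    then have "(m + 1) * (m + 2 * k) \<le> (m + k) * (m + k + 1)"
      by (simp add: algebra_simps)
    then have "(m + 1) * (m + 2 * k) * b \<le> (m + k) * (m + k + 1) * b"
      by (rule mult_right_mono) simp
    moreover have "2 * (m + 1) * (m + k) \<le> (m + k) * (m + k + 1) * 2"
      by (simp add: algebra_simps)
    ultimately have "(m + 1) * (m + 2 * k) * b + 2 * (m + 1) * (m + k)
        \<le> (m + k) * (m + k + 1) * b + (m + k) * (m + k + 1) * 2"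
      by (rule add_mono)
    then show ?thesis
      by (simp only: mult.assoc[of "m + 1" "m + 2 * k" b] distrib_left[of "(m + k) * (m + k + 1)" b 2])
  qed
  also have "\<dots> \<le> (m + k) * (m + k + 1) * (2 * a)"
    using ab by (intro mult_left_mono) auto
  also have "\<dots> = ((m + 1) * (m + k)) * (2 * a')"
    using arg_cong[OF a, of "\<lambda>x. (m + k) * 2 * x"] by (simp only: mult_ac)
  finally have "b' + 2 \<le> 2 * a'"
    using nat_mult_le_cancel1[of "(m + 1) * (m + k)"] k(1) by (metis add_gr_0 nat_0_less_mult_iff zero_less_one)
  then show ?thesis
    by (simp add: a'_def b'_def m mult_2 add.commute add.assoc)
qed

lemma binomial_bound:
  fixes n k :: nat
  assumes k: "0 < k" and n: "3 * real k ^ 2 - 3 * real k + 10 \<le> 2 * real n"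
  shows "((n - 1) choose k) + 2 \<le> 2 * ((n - k) choose k)"
proof (cases "k \<le> 40")
  case False
  then show ?thesis
    using binomial_bound_large n by simp
next
  case True
  have "even (k * k - k)"
    by auto
  then obtain h where h: "k * k - k = 2 * h" by blast
  have kk: "k * k = 2 * h + k"
    using h k by (metis le_add_diff_inverse2 le_square)
  \<comment> \<open>Since \<open>k * k - k = 2 * h\<close>, this is the least admissible
    \<open>n\<close>.\<close>
  define N where "N = 3 * h + 5"
  have kkr: "real k * real k = 2 * real h + real k"
    using kk by (metis of_nat_add of_nat_mult of_nat_numeral)
  have "0 \<le> (real k - 2)\<^sup>2"
    by simp
  then have N: "2 * k \<le> N"
    using kkr unfolding N_def power2_eq_square by (simp add: algebra_simps)
  have "N \<le> n"
    using n kkr by (simp add: N_def power2_eq_square)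
  then show ?thesis
  proof (induction n rule: dec_induct)
    case base
    have "(3 * int k * int k - 3 * int k + 10) div 2 = int N"
      using kk N_def by (simp add: mult.assoc of_nat_mult[symmetric] del: of_nat_mult)
    \<comment> \<open>\<open>falling (int k) k\<close> is \<open>fact k\<close>, so this is the
      claim multiplied by \<open>fact k\<close>.\<close>
    then have "falling (int (N - 1)) k + 2 * falling (int k) k \<le> 2 * falling (int (N - k)) k"
      using binomial_bound_small[OF k True] N by (simp add: of_nat_diff N_def)
    then have "int (fact k * ((N - 1 choose k) + 2)) \<le> int (fact k * (2 * (N - k choose k)))"
      unfolding falling_eq by (simp add: algebra_simps)
    then have "fact k * ((N - 1 choose k) + 2) \<le> fact k * (2 * (N - k choose k))"
      by (simp only: of_nat_le_iff)
    then show ?case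
      using nat_mult_le_cancel1[OF fact_gt_zero] by blast
  next
    case (step n)
    then show ?case
      using binomial_bound_step[of k n] k N by simp
  qed
qed

section \<open>Kneser graphs\<close>

lemma verts_kneser: "verts (kneser n k) = {A. A \<subseteq> {1..n} \<and> card A = k}"
  by (simp add: kneser_def Let_def)

lemma edge_kneser_iff:
  assumes "0 < k"
  shows "{A, B} \<in> edges (kneser n k) \<longleftrightarrow>
    A \<in> verts (kneser n k) \<and> B \<in> verts (kneser n k) \<and> A \<inter> B = {}"
proof
  assume "{A, B} \<in> edges (kneser n k)"
  then obtain A' B' where "{A, B} = {A', B'}" "A' \<in> verts (kneser n k)" "B' \<in> verts (kneser n k)"
      "A' \<inter> B' = {}"
    unfolding verts_kneser by (auto simp: kneser_def Let_def)
  then show "A \<in> verts (kneser n k) \<and> B \<in> verts (kneser n k) \<and> A \<inter> B = {}"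
    unfolding doubleton_eq_iff by auto
next
  assume AB: "A \<in> verts (kneser n k) \<and> B \<in> verts (kneser n k) \<and> A \<inter> B = {}"
  then have "A \<noteq> B"
    using assms unfolding verts_kneser by auto
  with AB show "{A, B} \<in> edges (kneser n k)"
    unfolding verts_kneser by (auto simp: kneser_def Let_def)
qed

lemma edge_kneserE:
  assumes "e \<in> uniform_edge_scramble (kneser n k)" "0 < k"
  obtains A B where "e = {A, B}" "A \<in> verts (kneser n k)" "B \<in> verts (kneser n k)" "A \<inter> B = {}"
  using assms by (auto simp: uniform_edge_scramble_def edge_kneser_iff)

lemma egg_edge:
  assumes "{u, v} \<in> edges G" "u \<in> verts G" "v \<in> verts G"
  shows "egg G {u, v}"
proof -
  have "(u, v) \<in> adj_rel (induced G {u, v})" "(v, u) \<in> adj_rel (induced G {u, v})"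
    using assms by (auto simp: adj_rel_def nbrs_def induced_def insert_commute)
  then show ?thesis
    using assms unfolding egg_def connected_graph_def conn_rel_def
    by (auto simp: induced_def)
qed

lemma scramble_uniform_edge_scramble:
  assumes "simple_graph G"
  shows "scramble G (uniform_edge_scramble G)"
  unfolding scramble_def
proof
  have "uniform_edge_scramble G \<subseteq> Pow (verts G)"
    using assms by (auto simp: uniform_edge_scramble_def simple_graph_def)
  then show "finite (uniform_edge_scramble G)"
    using assms finite_subset by (auto simp: simple_graph_def)
  show "\<forall>U\<in>uniform_edge_scramble G. egg G U"
    using assms by (auto simp: uniform_edge_scramble_def simple_graph_def intro!: egg_edge)
qed

text \<open>Needed for the \<open>Max\<close> in \<open>scramble_number\<close>: eggs are sets of
  vertices, so there are finitely many scrambles.\<close>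

lemma finite_scramble_orders:
  assumes "simple_graph G"
  shows "finite {scramble_order G S | S. scramble G S}"
proof -
  have "{scramble_order G S | S. scramble G S} \<subseteq> scramble_order G ` Pow (Pow (verts G))"
    by (auto simp: scramble_def egg_def)
  then show ?thesis
    by (rule finite_subset) (use assms in \<open>simp add: simple_graph_def\<close>)
qed

lemma hitting_number_uniform_edge_scramble_kneser:
  assumes k: "0 < k" "2 * k \<le> n"
  shows "(n - 1) choose k \<le> hitting_number (kneser n k) (uniform_edge_scramble (kneser n k))"
proof -
  let ?G = "kneser n k"
  let ?S = "uniform_edge_scramble ?G"
  \<comment> \<open>Some hitting set must exist for the \<open>LEAST\<close> to be attained.\<close>
  have "hitting_set ?G ?S (verts ?G)"
    unfolding hitting_set_def using k by (auto elim!: edge_kneserE)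
  then have "\<exists>m H. hitting_set ?G ?S H \<and> card H = m"
    by blast
  then obtain H where H: "hitting_set ?G ?S H" and cH: "card H = hitting_number ?G ?S"
    unfolding hitting_number_def using LeastI_ex[of "\<lambda>m. \<exists>H. hitting_set ?G ?S H \<and> card H = m"]
    by blast
  have fin: "finite (verts ?G)"
    using simple_graph_kneser[of n k] by (simp add: simple_graph_def)
  have HV: "H \<subseteq> verts ?G"
    using H by (simp add: hitting_set_def)
  have "card (verts ?G - H) \<le> (card {1..n} - 1) choose (k - 1)"
  proof (rule Erdos_Ko_Rado)
    show "A \<subseteq> {1..n} \<and> card A = k" if "A \<in> verts ?G - H" for A
      using that by (simp add: verts_kneser)
    fix A B assume AB: "A \<in> verts ?G - H" "B \<in> verts ?G - H"
    show "A \<inter> B \<noteq> {}"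
    proof
      assume "A \<inter> B = {}"
      then have "{A, B} \<in> ?S"
        using AB k by (auto simp: uniform_edge_scramble_def edge_kneser_iff)
      then have "H \<inter> {A, B} \<noteq> {}"
        using H unfolding hitting_set_def by blast
      then show False
        using AB by blast
    qed
  qed (use k in auto)
  then have "(n choose k) \<le> card H + ((n - 1) choose (k - 1))"
    using HV fin n_subsets[of "{1..n}" k]
    by (simp add: card_Diff_subset finite_subset verts_kneser)
  \<comment> \<open>By Pascal's rule, what Erdos-Ko-Rado leaves for \<open>H\<close> is exactly the
    claimed bound.\<close>
  moreover have "(n choose k) = ((n - 1) choose (k - 1)) + ((n - 1) choose k)"
    using k by (intro choose_reduce_nat) auto
  ultimately show ?thesis
    using cH by simp
qed

text \<open>The \<open>k\<close>-sets containing 1 are independent, and each has a neighbour because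
  \<open>2 * k \<le> n\<close> leaves \<open>k\<close> points outside it.\<close>

lemma kneser_positive_rank_divisor:
  assumes k: "0 < k" "2 * k \<le> n"
  obtains D where "divisor (kneser n k) D" "div_rank (kneser n k) D \<ge> 1"
    "deg (kneser n k) D = int ((n - 1) choose k)"
proof -
  let ?G = "kneser n k"
  define I where "I = {A \<in> verts ?G. 1 \<in> A}"
  define D where "D = ind (verts ?G - I)"
  have fin: "finite (verts ?G)"
    using simple_graph_kneser[of n k] by (simp add: simple_graph_def)
  have "{1..k} \<in> I"
    using k by (auto simp: I_def verts_kneser)
  have "div_rank ?G D \<ge> 1"
    unfolding D_def
  proof (rule div_rank_complement_independent[OF simple_graph_kneser])
    show "I \<subseteq> verts ?G" "I \<noteq> {}"
      using \<open>{1..k} \<in> I\<close> by (auto simp: I_def)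
    show "B \<notin> nbrs ?G A" if "A \<in> I" "B \<in> I" for A B
      using that k by (auto simp: I_def nbrs_def edge_kneser_iff)
    show "nbrs ?G A \<noteq> {}" if "A \<in> I" for A
    proof -
      have A: "A \<subseteq> {1..n}" "card A = k" "A \<in> verts ?G"
        using that by (auto simp: I_def verts_kneser)
      then have "k \<le> card ({1..n} - A)"
        using k finite_subset[OF A(1)] by (simp add: card_Diff_subset)
      then obtain B where "B \<subseteq> {1..n} - A" "card B = k"
        using obtain_subset_with_card_n by metis
      then have "B \<in> nbrs ?G A"
        using A k by (auto simp: nbrs_def edge_kneser_iff verts_kneser)
      then show ?thesis by blast
    qed
  qed
  moreover have "divisor ?G D"
    by (auto simp: divisor_def D_def ind_def)
  moreover have "deg ?G D = int ((n - 1) choose k)"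
  proof -
    have "deg ?G D = int (card (verts ?G - I))"
    proof -
      have "deg ?G D = (\<Sum>v\<in>verts ?G - I. 1)"
        unfolding deg_def using fin
        by (intro sum.mono_neutral_cong_right) (auto simp: D_def ind_def)
      then show ?thesis by simp
    qed
    also have "verts ?G - I = {A. A \<subseteq> {1..n} - {1} \<and> card A = k}"
      unfolding I_def verts_kneser by auto
    also have "card \<dots> = (n - 1) choose k"
      using n_subsets[of "{1..n} - {1}" k] k by simp
    finally show ?thesis .
  qed
  ultimately show ?thesis
    using that by blast
qed

theorem theorem1p4:
  fixes n k :: nat
  assumes "n > 0" and "k > 0"
    and "lambda2_optimal n k"
    and "real n \<ge> (3 * real k ^ 2 - 3 * real k + 10) / 2"
  shows "scramble_number (kneser n k) = enat ((n - 1) choose k) \<and>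
         gonality (kneser n k) = int ((n - 1) choose k)"
proof -
  let ?G = "kneser n k"
  let ?c = "(n - 1) choose k"
  let ?S = "uniform_edge_scramble ?G"
  note G = simple_graph_kneser[of n k]
  have n: "3 * real k ^ 2 - 3 * real k + 10 \<le> 2 * real n"
    using assms(4) by simp
  have "0 \<le> 3 * (real k - 1)\<^sup>2 + (real k - 2)\<^sup>2"
    by simp
  \<comment> \<open>7/6 completes the square:
    \<open>3 k^2 - 7 k + 10 = 3 (k - 7/6)^2 + 71/12\<close>.\<close>
  then have "4 * real k \<le> 2 * real n"
    using n zero_le_power2[of "real k - 7 / 6"] by (simp add: power2_eq_square algebra_simps)
  then have kn: "2 * k \<le> n"
    by linarith
  have scramble: "scramble ?G ?S"
    by (rule scramble_uniform_edge_scramble[OF G])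
  \<comment> \<open>The summand 2 in \<open>binomial_bound\<close> becomes the doubled
    \<open>- 1\<close> here.\<close>
  have "?c \<le> 2 * (((n - k) choose k) - 1)"
    using binomial_bound[OF assms(2) n] by simp
  then have lower: "enat ?c \<le> scramble_order ?G ?S"
    using hitting_number_uniform_edge_scramble_kneser[OF assms(2) kn] assms(3)
    by (simp add: scramble_order_def lambda2_optimal_def)
  have "{1..k} \<in> verts ?G"
    using kn by (auto simp: verts_kneser)
  then have V: "verts ?G \<noteq> {}"
    by blast
  obtain D where D: "divisor ?G D" "div_rank ?G D \<ge> 1" "deg ?G D = int ?c"
    using kneser_positive_rank_divisor[OF assms(2) kn] .
  have upper: "scramble_order ?G S \<le> enat ?c" if "scramble ?G S" for S
    using scramble_order_le_deg[OF G that V D(2)] D(3) by simp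
  have order: "scramble_order ?G ?S = enat ?c"
    using lower upper[OF scramble] by (rule antisym[rotated])
  have "scramble_number ?G = enat ?c"
    unfolding scramble_number_def
  proof (rule Max_eqI[OF finite_scramble_orders[OF G]])
    show "enat ?c \<in> {scramble_order ?G S | S. scramble ?G S}"
      using order scramble by force
  qed (use upper in auto)
  moreover have "gonality ?G = int ?c"
    unfolding gonality_def
  proof (rule Least_equality)
    show "\<exists>D. divisor ?G D \<and> div_rank ?G D \<ge> 1 \<and> deg ?G D = int ?c"
      using D by blast
    fix d assume "\<exists>D. divisor ?G D \<and> div_rank ?G D \<ge> 1 \<and> deg ?G D = d"
    then obtain D' where D': "div_rank ?G D' \<ge> 1" "deg ?G D' = d"
      by blast
    \<comment> \<open>\<open>nat d\<close> is 0 for negative \<open>d\<close>; positivity of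
      \<open>?c\<close> excludes that case.\<close>
    have pos: "0 < ?c"
      using kn assms(2) by simp
    have "enat ?c \<le> enat (nat d)"
      using scramble_order_le_deg[OF G scramble V D'(1)] order D'(2) by simp
    then have "?c \<le> nat d"
      by (simp only: enat_ord_simps)
    then show "int ?c \<le> d"
      using pos by linarith
  qed
  ultimately show ?thesis
    by simp
qed

end
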